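(* Let $\lambda>0$, let $\mathcal{O}$ (original) and $\mathcal{S}$ (synthetic) be two finite labelled datasets, and let $P_{\mathcal{O}},P_{\mathcal{S}}$ be the associated $L_2$-regularized empirical risk objectives and $D_{\mathcal{S}}$ the dual objective for $\mathcal{S}$ (as defined in the context), with $P_{\mathcal{O}},P_{\mathcal{S}}$ $\lambda$-strongly convex and with unique minimizers $\boldsymbol{\theta}_{\mathcal{O}}^*$ and $\boldsymbol{\theta}_{\mathcal{S}}^*$. Let $\tilde{\boldsymbol{\alpha}}_{\mathcal{S}}\in\mathrm{dom}(D_{\mathcal{S}})$ be any feasible dual variable and $G_{\mathcal{S}}(\boldsymbol{\theta}_{\mathcal{O}}^*,\tilde{\boldsymbol{\alpha}}_{\mathcal{S}}):=P_{\mathcal{S}}(\boldsymbol{\theta}_{\mathcal{O}}^* )-D_{\mathcal{S}}(\tilde{\boldsymbol{\alpha}}_{\mathcal{S}})$. Then for every $\boldsymbol{x}\in\mathbb{R}^d$, $$\bigl|f(\boldsymbol{x};\boldsymbol{\theta}_{\mathcal{S}}^* )-f(\boldsymbol{x};\boldsymbol{\theta}_{\mathcal{O}}^* )\bigr|\le\|\boldsymbol{\phi}(\boldsymbol{x})\|_2\,\|\boldsymbol{\theta}_{\mathcal{O}}^*-\boldsymbol{\theta}_{\mathcal{S}}^*\|_2\le\sqrt{k(\boldsymbol{x},\boldsymbol{x})\cdot\frac{2}{\lambda}\,G_{\mathcal{S}}(\boldsymbol{\theta}_{\mathcal{O}}^*,\tilde{\boldsymbol{\alpha}}_{\mathcal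{S}})}.$$
   Context: Let $\mathcal{H}$ be a real Hilbert space (a reproducing kernel Hilbert space), $\boldsymbol{\phi}:\mathbb{R}^d\to\mathcal{H}$ a feature map, and $k(\boldsymbol{x},\boldsymbol{x}')=\boldsymbol{\phi}(\boldsymbol{x})^\top\boldsymbol{\phi}(\boldsymbol{x}')$ the kernel, where $\boldsymbol{a}^\top\boldsymbol{b}$ denotes the inner product of $\mathcal{H}$ and $\|\cdot\|_2$ its norm. The model with parameter $\boldsymbol{\theta}\in\mathcal{H}$ is $f(\boldsymbol{x};\boldsymbol{\theta})=\boldsymbol{\phi}(\boldsymbol{x})^\top\boldsymbol{\theta}$. The loss $\ell(y,t)$ is a real-valued function of a label $y$ and a real prediction $t$, convex and continuous in $t$. The original dataset is $\mathcal{O}=\{(\boldsymbol{x}_i^{\mathcal{O}},y_i^{\mathcal{O}})\}_{i=1}^{n_{\mathcal{O}}}$ with $\boldsymbol{x}_i^{\mathcal{O}}\in\mathbb{R}^d$, $y_i^{\mathcal{O}}\in\{-1,+1\}$; the synthetic dataset is $\mathcal{S}=\{(\boldsymbol{x}_i^{\mathcal{S}},y_i^{\mathcal{S}})\}_{i=1}^{n_{\mathcal{S}}}$ with $\boldsymbol{x}_i^{\mathcal{S}}\in\mathbb{R}^d$, $y_i^{\mathcal{S}}\in\mathbb{R}$. For $\mathcal{D}\in\{\mathcal{O},\mathcal{S}\}$ the primal objective is $$P_{\mathcal{D}}(\boldsymbol{\theta})=\sum_{i=1}^{n_{\mathcal{D}}}\ell(y_i^{\mathcal{D}},f(\boldsymbol{x}_i^{\mathcal{D}};\boldsymbol{\theta}))+\frac{\lambda}{2}\|\boldsymbol{\theta}\|_2^2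 .$$ The dual objective for $\mathcal{S}$ is, for $\boldsymbol{\alpha}\in\mathbb{R}^{n_{\mathcal{S}}}$, $$D_{\mathcal{S}}(\boldsymbol{\alpha})=-\sum_{i=1}^{n_{\mathcal{S}}}\ell^*(y_i^{\mathcal{S}},-y_i^{\mathcal{S}}\alpha_i)-\frac{1}{2\lambda}\sum_{i=1}^{n_{\mathcal{S}}}\sum_{j=1}^{n_{\mathcal{S}}}\alpha_i\alpha_j\,y_i^{\mathcal{S}}y_j^{\mathcal{S}}\,k(\boldsymbol{x}_i^{\mathcal{S}},\boldsymbol{x}_j^{\mathcal{S}}),$$ where $\ell^*(y,s)=\sup_{t\in\mathbb{R}}\{st-\ell(y,t)\}$ is the convex conjugate in the second argument, and $\mathrm{dom}(D_{\mathcal{S}})=\{\boldsymbol{\alpha}:D_{\mathcal{S}}(\boldsymbol{\alpha})>-\infty\}$ is the set of feasible dual variables. A convex function $F$ with nonempty domain is $\lambda$-strongly convex if for all $\boldsymbol{\theta},\boldsymbol{\theta}'\in\mathrm{dom}(F)$ and every subgradient $\boldsymbol{g}\in\partial F(\boldsymbol{\theta}')$ one has $F(\boldsymbol{\theta})-F(\boldsymbol{\theta}')\ge\boldsymbol{g}^\top(\boldsymbol{\theta}-\boldsymbol{\theta}')+\frac{\lambda}{2}\|\boldsymbol{\theta}-\boldsymbol{\theta}'\|_2^2$. *)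

theory Defs
  imports "HOL-Analysis.Analysis"
begin

type_synonym 'd dataset = "((real ^ 'd) \<times> real) list"

definition feature_kernel :: "(real ^ 'd \<Rightarrow> 'h :: real_inner) \<Rightarrow> real ^ 'd \<Rightarrow> real ^ 'd \<Rightarrow> real" where
  "feature_kernel \<phi> x x' = \<phi> x \<bullet> \<phi> x'"

definition model :: "(real ^ 'd \<Rightarrow> 'h :: real_inner) \<Rightarrow> 'h \<Rightarrow> real ^ 'd \<Rightarrow> real" where
  "model \<phi> \<theta> x = \<phi> x \<bullet> \<theta>"

definition primal_objective ::
  "(real \<Rightarrow> real \<Rightarrow> real) \<Rightarrow> (real ^ 'd \<Rightarrow> 'h :: real_inner) \<Rightarrow> real \<Rightarrow> 'd dataset \<Rightarrow> 'h \<Rightarrow> real" where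
  "primal_objective \<l> \<phi> lam \<D> \<theta> =
     (\<Sum>i<length \<D>. \<l> (snd (\<D> ! i)) (model \<phi> \<theta> (fst (\<D> ! i)))) + lam / 2 * (norm \<theta>)\<^sup>2"

definition loss_conjugate :: "(real \<Rightarrow> real \<Rightarrow> real) \<Rightarrow> real \<Rightarrow> real \<Rightarrow> ereal" where
  "loss_conjugate \<l> y s = (SUP t. ereal (s * t - \<l> y t))"

(* Every conjugate value exceeds -\<infinity>, so the sum of conjugates never adds
   infinities of opposite sign; it is \<infinity> iff one of its terms is. *)
definition dual_objective ::
  "(real \<Rightarrow> real \<Rightarrow> real) \<Rightarrow> (real ^ 'd \<Rightarrow> 'h :: real_inner) \<Rightarrow> real \<Rightarrow> 'd dataset \<Rightarrow> real list \<Rightarrow> ereal" where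
  "dual_objective \<l> \<phi> lam \<D> \<alpha> =
     - (\<Sum>i<length \<D>. loss_conjugate \<l> (snd (\<D> ! i)) (- snd (\<D> ! i) * \<alpha> ! i))
     - ereal (1 / (2 * lam) *
         (\<Sum>i<length \<D>. \<Sum>j<length \<D>.
            \<alpha> ! i * \<alpha> ! j * snd (\<D> ! i) * snd (\<D> ! j) * feature_kernel \<phi> (fst (\<D> ! i)) (fst (\<D> ! j))))"

(* A vector of n dual variables is a list of length n, n the size of the dataset. *)
definition dual_domain ::
  "(real \<Rightarrow> real \<Rightarrow> real) \<Rightarrow> (real ^ 'd \<Rightarrow> 'h :: real_inner) \<Rightarrow> real \<Rightarrow> 'd dataset \<Rightarrow> real list set" where
  "dual_domain \<l> \<phi> lam \<D> =
     {\<alpha>. length \<alpha> = length \<D> \<and> dual_objective \<l> \<phi> lam \<D> \<alpha> > - \<infinity>}"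

definition duality_gap ::
  "(real \<Rightarrow> real \<Rightarrow> real) \<Rightarrow> (real ^ 'd \<Rightarrow> 'h :: real_inner) \<Rightarrow> real \<Rightarrow> 'd dataset \<Rightarrow> 'h \<Rightarrow> real list \<Rightarrow> ereal" where
  "duality_gap \<l> \<phi> lam \<D> \<theta> \<alpha> =
     ereal (primal_objective \<l> \<phi> lam \<D> \<theta>) - dual_objective \<l> \<phi> lam \<D> \<alpha>"

(* An extended-valued function is given by its domain S and its finite values on S. *)
definition subdifferential :: "'h :: real_inner set \<Rightarrow> ('h \<Rightarrow> real) \<Rightarrow> 'h \<Rightarrow> 'h set" where
  "subdifferential S F \<theta>' = {g. \<forall>\<theta>\<in>S. F \<theta> \<ge> F \<theta>' + g \<bullet> (\<theta> - \<theta>')}"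

definition strongly_convex_on :: "'h :: real_inner set \<Rightarrow> real \<Rightarrow> ('h \<Rightarrow> real) \<Rightarrow> bool" where
  "strongly_convex_on S lam F \<longleftrightarrow>
     S \<noteq> {} \<and> convex_on S F \<and>
     (\<forall>\<theta>\<in>S. \<forall>\<theta>'\<in>S. \<forall>g\<in>subdifferential S F \<theta>'.
        F \<theta> - F \<theta>' \<ge> g \<bullet> (\<theta> - \<theta>') + lam / 2 * (norm (\<theta> - \<theta>'))\<^sup>2)"

definition unique_minimizer :: "('h \<Rightarrow> real) \<Rightarrow> 'h \<Rightarrow> bool" where
  "unique_minimizer F \<theta> \<longleftrightarrow> {\<theta>'. is_arg_min F (\<lambda>_. True) \<theta>'} = {\<theta>}"

lemma loss_conjugate_not_minf: "loss_conjugate \<l> y s \<noteq> - \<infinity>"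
proof -
  have "ereal (s * 0 - \<l> y 0) \<le> loss_conjugate \<l> y s"
    unfolding loss_conjugate_def by (rule SUP_upper) simp
  then show ?thesis by auto
qed

lemma sum_loss_conjugate_not_minf:
  assumes "finite A"
  shows "(\<Sum>i\<in>A. loss_conjugate \<l> (y i) (s i)) \<noteq> - \<infinity>"
  using assms by (induction rule: finite_induct) (simp_all add: loss_conjugate_not_minf)

(* The gap is a real number at feasible dual variables, so real_of_ereal loses
   nothing there. *)
lemma duality_gap_finite:
  assumes "\<alpha> \<in> dual_domain \<l> \<phi> lam \<D>"
  shows "\<bar>duality_gap \<l> \<phi> lam \<D> \<theta> \<alpha>\<bar> \<noteq> \<infinity>"
proof -
  have finite_gap: "\<bar>ereal p - (- c - ereal q)\<bar> \<noteq> \<infinity>"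
    if "c \<noteq> - \<infinity>" and "- c - ereal q > - \<infinity>" for c p q
    using that by (cases c) simp_all
  have "dual_objective \<l> \<phi> lam \<D> \<alpha> > - \<infinity>"
    using assms by (simp only: dual_domain_def mem_Collect_eq)
  then show ?thesis
    unfolding duality_gap_def dual_objective_def
    by (rule finite_gap[OF sum_loss_conjugate_not_minf[OF finite_lessThan]])
qed

end

theory Submission
  imports Defs
begin

(* The zero vector is a subgradient of P_S at its minimizer, so strong convexity gives
   lam / 2 * |\<theta>\<^sub>O - \<theta>\<^sub>S|^2 \<le> P_S(\<theta>\<^sub>O) - P_S(\<theta>\<^sub>S).  Weak duality bounds P_S(\<theta>\<^sub>S) from below by
   D_S(\<alpha>), and the prediction gap is controlled by Cauchy-Schwarz. *)

lemma zero_in_subdifferential_if_minimizer: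
  assumes "unique_minimizer F \<theta>"
  shows "0 \<in> subdifferential UNIV F \<theta>"
proof -
  have "is_arg_min F (\<lambda>_. True) \<theta>"
    using assms unfolding unique_minimizer_def by blast
  then show ?thesis
    by (simp add: subdifferential_def is_arg_min_linorder)
qed

lemma strongly_convex_quadratic_growth:
  assumes "strongly_convex_on UNIV lam F" and "unique_minimizer F \<theta>'"
  shows "lam / 2 * (norm (\<theta> - \<theta>'))\<^sup>2 \<le> F \<theta> - F \<theta>'"
proof -
  have "0 \<bullet> (\<theta> - \<theta>') + lam / 2 * (norm (\<theta> - \<theta>'))\<^sup>2 \<le> F \<theta> - F \<theta>'"
    using assms(1) zero_in_subdifferential_if_minimizer[OF assms(2)]
    unfolding strongly_convex_on_def by blast
  then show ?thesis by simp
qed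

text \<open>Expanding the square of \<open>v - lam *\<^sub>R w\<close> and dividing by
  \<open>2 * lam\<close> gives the bound. It is the Fenchel-Young inequality for the regularizer
  \<open>lam / 2 * (norm w)\<^sup>2\<close>, with equality at
  \<open>v = lam *\<^sub>R w\<close>.\<close>

lemma inner_young:
  fixes v w :: "'h :: real_inner"
  assumes "lam > 0"
  shows "v \<bullet> w \<le> 1 / (2 * lam) * (v \<bullet> v) + lam / 2 * (norm w)\<^sup>2"
proof -
  have "0 \<le> (v - lam *\<^sub>R w) \<bullet> (v - lam *\<^sub>R w)"
    by (rule inner_ge_zero)
  also have "\<dots> = v \<bullet> v - 2 * lam * (v \<bullet> w) + lam * lam * (w \<bullet> w)"
    by (simp add: inner_diff_left inner_diff_right inner_commute[of w v] algebra_simps)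
  finally have "2 * lam * (v \<bullet> w) \<le> v \<bullet> v + lam * lam * (w \<bullet> w)"
    by simp
  with assms show ?thesis
    by (simp add: power2_norm_eq_inner field_simps)
qed

text \<open>Fenchel-Young is applied once per sample to the loss and once to the regularizer. The
  two linear terms, \<open>- (w \<bullet> \<theta>)\<close> and \<open>w \<bullet> \<theta>\<close>,
  cancel when the inequalities are added.\<close>

lemma weak_duality:
  fixes \<phi> :: "real ^ 'd \<Rightarrow> 'h :: real_inner"
  assumes "lam > 0"
  shows "dual_objective \<l> \<phi> lam \<D> \<alpha> \<le> ereal (primal_objective \<l> \<phi> lam \<D> \<theta>)"
proof -
  define y where "y i = snd (\<D> ! i)" for i
  define \<psi> where "\<psi> i = \<phi> (fst (\<D> ! i))" for i
  \<comment> \<open>\<open>w\<close> gathers the dual variables into one vector of the feature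
    space; \<open>w\<close> divided by \<open>lam\<close> is the parameter at which the regularizer
    inequality is tight.\<close>
  define w where "w = (\<Sum>i<length \<D>. (\<alpha> ! i * y i) *\<^sub>R \<psi> i)"
  define L where "L = (\<Sum>i<length \<D>. \<l> (y i) (\<psi> i \<bullet> \<theta>))"
  define C where "C = (\<Sum>i<length \<D>. loss_conjugate \<l> (y i) (- y i * \<alpha> ! i))"
  have "ereal (- (w \<bullet> \<theta>) - L)
      = (\<Sum>i<length \<D>. ereal (- y i * \<alpha> ! i * (\<psi> i \<bullet> \<theta>) - \<l> (y i) (\<psi> i \<bullet> \<theta>)))"
    by (simp add: w_def L_def inner_sum_left sum_subtractf sum_negf mult_ac)
  \<comment> \<open>Each conjugate is a supremum over predictions t, bounded below by its value at
    the actual prediction \<open>\<psi> i \<bullet> \<theta>\<close>.\<close>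
  also have "\<dots> \<le> C"
    unfolding C_def loss_conjugate_def by (intro sum_mono SUP_upper UNIV_I)
  finally have fenchel: "ereal (- (w \<bullet> \<theta>) - L) \<le> C" .
  \<comment> \<open>The quadratic form of the Gram matrix is a squared norm, which brings the dual
    penalty into the shape of \<open>inner_young\<close>.\<close>
  have kernel: "(\<Sum>i<length \<D>. \<Sum>j<length \<D>.
      \<alpha> ! i * \<alpha> ! j * y i * y j * feature_kernel \<phi> (fst (\<D> ! i)) (fst (\<D> ! j))) = w \<bullet> w"
    by (simp add: w_def \<psi>_def feature_kernel_def inner_sum_left inner_sum_right
        sum_distrib_left inner_commute mult_ac)
  have dual: "dual_objective \<l> \<phi> lam \<D> \<alpha> = - C - ereal (1 / (2 * lam) * (w \<bullet> w))"
    unfolding dual_objective_def C_def kernel[symmetric] y_def ..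
  have primal: "primal_objective \<l> \<phi> lam \<D> \<theta> = L + lam / 2 * (norm \<theta>)\<^sup>2"
    by (simp add: primal_objective_def L_def y_def \<psi>_def model_def)
  show ?thesis
    using fenchel inner_young[OF assms, of w \<theta>] unfolding dual primal
    \<comment> \<open>If \<open>C\<close> is \<infinity>, the dual value is -\<infinity>;
      \<open>fenchel\<close> rules out -\<infinity> for \<open>C\<close>; the finite case adds the
      two real inequalities.\<close>
    by (cases C) (simp_all del: times_divide_eq_left)
qed

lemma duality_gap_ge_primal_diff:
  fixes \<phi> :: "real ^ 'd \<Rightarrow> 'h :: real_inner"
  assumes "lam > 0" and "\<alpha> \<in> dual_domain \<l> \<phi> lam \<D>"
  shows "primal_objective \<l> \<phi> lam \<D> \<theta> - primal_objective \<l> \<phi> lam \<D> \<theta>'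
      \<le> real_of_ereal (duality_gap \<l> \<phi> lam \<D> \<theta> \<alpha>)"
proof -
  have "dual_objective \<l> \<phi> lam \<D> \<alpha> > - \<infinity>"
    using assms(2) by (simp add: dual_domain_def)
  with weak_duality[OF assms(1), of \<l> \<phi> \<D> \<alpha> \<theta>'] show ?thesis
    unfolding duality_gap_def
    \<comment> \<open>Feasibility excludes -\<infinity> and weak duality at \<open>\<theta>'\<close>
      excludes \<infinity>, so the claim becomes one about reals.\<close>
    by (cases "dual_objective \<l> \<phi> lam \<D> \<alpha>") simp_all
qed

theorem mainTheorem2:
  fixes \<phi> :: "real ^ 'd \<Rightarrow> 'h :: {real_inner, complete_space}"
    and \<l> :: "real \<Rightarrow> real \<Rightarrow> real"
    and lam :: real
    and \<O> \<S> :: "'d dataset"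
    and \<theta>\<^sub>O \<theta>\<^sub>S :: 'h
    and \<alpha> :: "real list"
  assumes "lam > 0"
    and "\<And>y. convex_on UNIV (\<l> y)"
    and "\<And>y. continuous_on UNIV (\<l> y)"
    and "\<forall>(x, y)\<in>set \<O>. y \<in> {-1, 1}"
    and "strongly_convex_on UNIV lam (primal_objective \<l> \<phi> lam \<O>)"
    and "strongly_convex_on UNIV lam (primal_objective \<l> \<phi> lam \<S>)"
    and "unique_minimizer (primal_objective \<l> \<phi> lam \<O>) \<theta>\<^sub>O"
    and "unique_minimizer (primal_objective \<l> \<phi> lam \<S>) \<theta>\<^sub>S"
    and "\<alpha> \<in> dual_domain \<l> \<phi> lam \<S>"
  shows "\<forall>x. \<bar>model \<phi> \<theta>\<^sub>S x - model \<phi> \<theta>\<^sub>O x\<bar> \<le> norm (\<phi> x) * norm (\<theta>\<^sub>O - \<theta>\<^sub>S) \<and>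
             norm (\<phi> x) * norm (\<theta>\<^sub>O - \<theta>\<^sub>S)
               \<le> sqrt (feature_kernel \<phi> x x * (2 / lam) * real_of_ereal (duality_gap \<l> \<phi> lam \<S> \<theta>\<^sub>O \<alpha>))"
proof (intro allI conjI)
  fix x
  show "\<bar>model \<phi> \<theta>\<^sub>S x - model \<phi> \<theta>\<^sub>O x\<bar> \<le> norm (\<phi> x) * norm (\<theta>\<^sub>O - \<theta>\<^sub>S)"
    using Cauchy_Schwarz_ineq2[of "\<phi> x" "\<theta>\<^sub>S - \<theta>\<^sub>O"]
    by (simp add: model_def inner_diff_right norm_minus_commute)
  define g where "g = real_of_ereal (duality_gap \<l> \<phi> lam \<S> \<theta>\<^sub>O \<alpha>)"
  have "lam / 2 * (norm (\<theta>\<^sub>O - \<theta>\<^sub>S))\<^sup>2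
      \<le> primal_objective \<l> \<phi> lam \<S> \<theta>\<^sub>O - primal_objective \<l> \<phi> lam \<S> \<theta>\<^sub>S"
    using assms(6,8) by (rule strongly_convex_quadratic_growth)
  also have "\<dots> \<le> g"
    unfolding g_def using assms(1,9) by (rule duality_gap_ge_primal_diff)
  finally have dist: "(norm (\<theta>\<^sub>O - \<theta>\<^sub>S))\<^sup>2 \<le> 2 / lam * g"
    using assms(1) by (simp add: field_simps)
  \<comment> \<open>Squares are compared first: the squared feature norm is the kernel on the
    diagonal, and the root is taken only at the end.\<close>
  have "(norm (\<phi> x) * norm (\<theta>\<^sub>O - \<theta>\<^sub>S))\<^sup>2 \<le> (norm (\<phi> x))\<^sup>2 * (2 / lam * g)"
    unfolding power_mult_distrib using dist by (rule mult_left_mono) simp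
  also have "\<dots> = feature_kernel \<phi> x x * (2 / lam) * g"
    by (simp only: feature_kernel_def power2_norm_eq_inner mult.assoc)
  finally show "norm (\<phi> x) * norm (\<theta>\<^sub>O - \<theta>\<^sub>S) \<le> sqrt (feature_kernel \<phi> x x * (2 / lam) * g)"
    by (rule real_le_rsqrt)
qed

end
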